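(* Let $\tilde\alpha,\tilde\beta\in\mathbb{C}$, let $\tau_1,\dots,\tau_5\in\mathbb{C}$ be non-zero, and let $(\tau_n)_{n\in\mathbb{Z}}$ be the Somos 5 sequence defined by $$\tau_{n+3}\tau_{n-2}=\tilde\alpha\,\tau_{n+2}\tau_{n-1}+\tilde\beta\,\tau_{n+1}\tau_n$$ with initial data $\tau_1,\dots,\tau_5$. Then the quantity $$\tilde J=\frac{\tau_{n+1}\tau_{n-2}}{\tau_n\tau_{n-1}}+\frac{\tau_{n+2}\tau_{n-1}}{\tau_{n+1}\tau_n}+\tilde\alpha\left(\frac{\tau_n\tau_{n-1}}{\tau_{n+1}\tau_{n-2}}+\frac{\tau_{n+1}\tau_n}{\tau_{n+2}\tau_{n-1}}\right)+\tilde\beta\,\frac{(\tau_n)^2}{\tau_{n+2}\tau_{n-2}}$$ is independent of $n$ (that is, it takes the same value for all $n$ such that $\tau_{n-2},\tau_{n-1},\tau_n,\tau_{n+1},\tau_{n+2}$ are all non-zero, in particular the value at $n=3$). Moreover, with $\tilde{\mathcal I}=\tilde\beta+\tilde\alpha\tilde J$, $$\tau_n\in\mathbb{Z}[\tilde\alpha,\tilde\beta,\tilde{\mathcal I},\tau_1^{\pm1},\tau_2^{\pm1},\tau_3,\tau_4,\tau_5]\qquad\text{for all } n\ge1,$$ where the right-hand side denotes the ring generated over $\mathbb{Z}$ by the listed elements.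
   Context: The recurrence is iterated forwards and backwards from five adjacent non-zero values $\tau_1,\dots,\tau_5$, giving a sequence indexed by $\mathbb{Z}$. Convention on zeros: if a zero term is encountered, the sequence is analytically continued through it. That is, $\tau_n$ is by definition the value at the given data of the rational function of $\tilde\alpha,\tilde\beta,\tau_1,\dots,\tau_5$ obtained by iterating the recurrence formally with these quantities as indeterminates; it is known (the Laurent property of Fomin and Zelevinsky) that this rational function lies in $\mathbb{Z}[\tilde\alpha,\tilde\beta,\tau_1^{\pm1},\dots,\tau_5^{\pm1}]$, so its value is well defined whenever $\tau_1,\dots,\tau_5$ are non-zero. *)

theory Defs
  imports
    Complex_Main
    "HOL-Library.Poly_Mapping"
    "HOL-Computational_Algebra.Fraction_Field"
    "HOL-Algebra.Generated_Rings"
    "HOL-Algebra.Algebraic_Closure_Type"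
begin

text \<open>
  Polynomials over \<open>\<int>\<close> in indeterminates indexed by \<open>int\<close>: the keys of the outer mapping are
  the power products. Only the indices \<open>0, \<dots>, 6\<close> are used: \<open>1, \<dots>, 5\<close> for the initial values,
  \<open>0\<close> and \<open>6\<close> for the two coefficients of the recurrence.
\<close>

type_synonym int_mpoly = "(int \<Rightarrow>\<^sub>0 nat) \<Rightarrow>\<^sub>0 int"

definition mpoly_eval :: "(int \<Rightarrow> 'a::comm_ring_1) \<Rightarrow> int_mpoly \<Rightarrow> 'a" where
  "mpoly_eval x p =
     (\<Sum>m\<in>Poly_Mapping.keys p. of_int (Poly_Mapping.lookup p m) *
        (\<Prod>i\<in>Poly_Mapping.keys m. x i ^ Poly_Mapping.lookup m i))"

definition indet :: "int \<Rightarrow> int_mpoly fract" where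
  "indet i = Fract (Poly_Mapping.single (Poly_Mapping.single i 1) 1) 1"

abbreviation indet_alpha :: "int_mpoly fract" where "indet_alpha \<equiv> indet 0"
abbreviation indet_beta :: "int_mpoly fract" where "indet_beta \<equiv> indet 6"

text \<open>
  The value of a rational function is taken along any representation whose denominator does not
  vanish at the given point; it does not depend on the representation (\<open>rat_value_Fract\<close> below),
  and it is unspecified if there is no such representation.
\<close>

definition rat_value :: "(int \<Rightarrow> 'a::field) \<Rightarrow> int_mpoly fract \<Rightarrow> 'a" where
  "rat_value x r =
     (THE v. \<exists>p q. mpoly_eval x q \<noteq> 0 \<and> r = Fract p q \<and> v = mpoly_eval x p / mpoly_eval x q)"

text \<open>The recurrence, solved for its term of highest index if \<open>n > 5\<close>, of lowest index if \<open>n < 1\<close>.\<close>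

function somos5_formal :: "int \<Rightarrow> int_mpoly fract" where
  "somos5_formal n =
     (if 1 \<le> n \<and> n \<le> 5 then indet n
      else if n > 5 then
        (indet_alpha * somos5_formal (n - 1) * somos5_formal (n - 4)
          + indet_beta * somos5_formal (n - 2) * somos5_formal (n - 3)) / somos5_formal (n - 5)
      else
        (indet_alpha * somos5_formal (n + 4) * somos5_formal (n + 1)
          + indet_beta * somos5_formal (n + 3) * somos5_formal (n + 2)) / somos5_formal (n + 5))"
  by auto
termination by (relation "measure (\<lambda>n. nat \<bar>n - 3\<bar>)") auto

declare somos5_formal.simps [simp del]

text \<open>Only the values of \<open>t\<close> at \<open>1, \<dots>, 5\<close> matter.\<close>

definition somos5 :: "complex \<Rightarrow> complex \<Rightarrow> (int \<Rightarrow> complex) \<Rightarrow> int \<Rightarrow> complex" where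
  "somos5 \<alpha> \<beta> t n = rat_value (t(0 := \<alpha>, 6 := \<beta>)) (somos5_formal n)"

definition somos5_J :: "'a::field \<Rightarrow> 'a \<Rightarrow> (int \<Rightarrow> 'a) \<Rightarrow> int \<Rightarrow> 'a" where
  "somos5_J \<alpha> \<beta> \<tau> n =
     \<tau> (n + 1) * \<tau> (n - 2) / (\<tau> n * \<tau> (n - 1))
     + \<tau> (n + 2) * \<tau> (n - 1) / (\<tau> (n + 1) * \<tau> n)
     + \<alpha> * (\<tau> n * \<tau> (n - 1) / (\<tau> (n + 1) * \<tau> (n - 2))
            + \<tau> (n + 1) * \<tau> n / (\<tau> (n + 2) * \<tau> (n - 1)))
     + \<beta> * ((\<tau> n)\<^sup>2 / (\<tau> (n + 2) * \<tau> (n - 2)))"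

abbreviation int_adjoin :: "'a::comm_ring_1 set \<Rightarrow> 'a set" where
  "int_adjoin S \<equiv> generate_ring ring_of_type_algebra S"


lemma mpoly_eval_superset:
  assumes "finite A" "Poly_Mapping.keys p \<subseteq> A"
  shows "mpoly_eval x p = (\<Sum>m\<in>A. of_int (Poly_Mapping.lookup p m) *
           (\<Prod>i\<in>Poly_Mapping.keys m. x i ^ Poly_Mapping.lookup m i))"
  unfolding mpoly_eval_def using assms
  by (intro sum.mono_neutral_left) (auto simp: in_keys_iff)

lemma mpoly_eval_add: "mpoly_eval x (p + q) = mpoly_eval x p + mpoly_eval x q"
proof -
  let ?A = "Poly_Mapping.keys p \<union> Poly_Mapping.keys q"
  have "finite ?A" by simp
  moreover have "Poly_Mapping.keys (p + q) \<subseteq> ?A" by (rule Poly_Mapping.keys_add)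
  ultimately show ?thesis
    by (simp add: mpoly_eval_superset[of ?A] lookup_add algebra_simps sum.distrib)
qed

lemma mpoly_eval_0 [simp]: "mpoly_eval x 0 = 0"
  by (simp add: mpoly_eval_def)

lemma mpoly_eval_single:
  "mpoly_eval x (Poly_Mapping.single m c) =
     of_int c * (\<Prod>i\<in>Poly_Mapping.keys m. x i ^ Poly_Mapping.lookup m i)"
  by (simp add: mpoly_eval_def)

lemma power_product_add:
  fixes m n :: "int \<Rightarrow>\<^sub>0 nat" and x :: "int \<Rightarrow> 'a::comm_ring_1"
  shows "(\<Prod>i\<in>Poly_Mapping.keys (m + n). x i ^ Poly_Mapping.lookup (m + n) i) =
    (\<Prod>i\<in>Poly_Mapping.keys m. x i ^ Poly_Mapping.lookup m i) *
    (\<Prod>i\<in>Poly_Mapping.keys n. x i ^ Poly_Mapping.lookup n i)"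
proof -
  let ?A = "Poly_Mapping.keys m \<union> Poly_Mapping.keys n"
  have *: "(\<Prod>i\<in>Poly_Mapping.keys k. x i ^ Poly_Mapping.lookup k i) =
      (\<Prod>i\<in>?A. x i ^ Poly_Mapping.lookup k i)" if "Poly_Mapping.keys k \<subseteq> ?A" for k
    using that by (intro prod.mono_neutral_left) (auto simp: in_keys_iff)
  show ?thesis
    using *[OF Poly_Mapping.keys_add[of m n]] *[of m] *[of n]
    by (simp add: lookup_add power_add prod.distrib)
qed

lemma mpoly_as_sum_singles:
  "(p :: int_mpoly) =
     (\<Sum>m\<in>Poly_Mapping.keys p. Poly_Mapping.single m (Poly_Mapping.lookup p m))"
  by (rule poly_mapping_eqI)
     (auto simp: lookup_sum lookup_single when_def in_keys_iff sum.delta)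

lemma mpoly_eval_sum: "mpoly_eval x (sum f A) = (\<Sum>a\<in>A. mpoly_eval x (f a))"
  by (induction A rule: infinite_finite_induct) (simp_all add: mpoly_eval_add)

lemma mpoly_eval_mult: "mpoly_eval x (p * q) = mpoly_eval x p * mpoly_eval x q"
proof -
  have "mpoly_eval x (p * q) =
      mpoly_eval x ((\<Sum>m\<in>Poly_Mapping.keys p. Poly_Mapping.single m (Poly_Mapping.lookup p m)) *
        (\<Sum>m\<in>Poly_Mapping.keys q. Poly_Mapping.single m (Poly_Mapping.lookup q m)))"
    using mpoly_as_sum_singles[of p] mpoly_as_sum_singles[of q] by simp
  also have "\<dots> = mpoly_eval x p * mpoly_eval x q"
    unfolding mpoly_eval_def[of x p] mpoly_eval_def[of x q] sum_product
    by (simp add: mpoly_eval_sum mult_single mpoly_eval_single power_product_add mult_ac)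
  finally show ?thesis .
qed

lemma mpoly_eval_1 [simp]: "mpoly_eval x 1 = 1"
  using mpoly_eval_single[of x 0 1] by simp

lemma rat_value_Fract:
  assumes "mpoly_eval x q \<noteq> 0"
  shows "rat_value x (Fract p q) = mpoly_eval x p / mpoly_eval x q"
  unfolding rat_value_def
proof (rule the_equality)
  show "\<exists>p' q'. mpoly_eval x q' \<noteq> 0 \<and> Fract p q = Fract p' q' \<and>
      mpoly_eval x p / mpoly_eval x q = mpoly_eval x p' / mpoly_eval x q'"
    using assms by blast
next
  fix v
  assume "\<exists>p' q'. mpoly_eval x q' \<noteq> 0 \<and> Fract p q = Fract p' q' \<and>
      v = mpoly_eval x p' / mpoly_eval x q'"
  then obtain p' q' where *: "mpoly_eval x q' \<noteq> 0" "Fract p q = Fract p' q'"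
    "v = mpoly_eval x p' / mpoly_eval x q'" by blast
  from assms *(1) have "q \<noteq> 0" "q' \<noteq> 0" by auto
  with *(2) have "p * q' = p' * q" by (simp add: eq_fract)
  then have "mpoly_eval x p * mpoly_eval x q' = mpoly_eval x p' * mpoly_eval x q"
    by (metis mpoly_eval_mult)
  then show "v = mpoly_eval x p / mpoly_eval x q"
    using *(1) assms unfolding *(3) by (simp add: frac_eq_eq)
qed

lemma somos5_initial:
  assumes "n \<in> {1..5}"
  shows "somos5 \<alpha> \<beta> t n = t n"
proof -
  have "somos5_formal n = indet n" using assms by (subst somos5_formal.simps) auto
  then show ?thesis
    using assms by (simp add: somos5_def indet_def rat_value_Fract mpoly_eval_single)
qed

end

theory Submission
  imports Defs
begin

text \<open>
  The idea is to describe products \<open>f (k + 2 j + 3) f k\<close>, whose indices have an odd sum and may be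
  far apart, by the two neighbouring products with the same index sum. If \<open>f\<close> satisfies the Somos 5
  recurrence with invariant \<open>J\<close>, then
  \<open>f (k + 2 j + 3) f k = c (j + 2) c (j + 1) f (k + j + 3) f (k + j)
  - c (j + 3) c j f (k + j + 2) f (k + j + 1)\<close>,
  where the companion sequence \<open>c = 0, 1, 1, \<alpha>, - \<beta>, - (\<alpha>\<^sup>3 + \<beta> I), \<dots>\<close> with \<open>I = \<beta> + \<alpha> J\<close> is the
  solution of the same recurrence, with the same \<open>J\<close>, that starts at a zero: it is the elliptic
  divisibility sequence of the underlying curve, with its terms of even index divided by the
  second one. The formula is the three-term relation of the sigma function. It is proved
  algebraically (\<open>addition_formula\<close>): the product of two such expressions at levels \<open>j\<close> and \<open>j + 2\<close> is
  the product of two at level \<open>j + 1\<close>, and the resulting polynomial identity follows from the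
  recurrence and the invariant for \<open>f\<close> and for \<open>c\<close>.

  Now put \<open>k = 1\<close> and \<open>k = 2\<close>. Every term of index above \<open>5\<close> becomes a polynomial in earlier terms and
  in terms of \<open>c\<close>, divided by \<open>f 1\<close> or \<open>f 2\<close> only. Applied to \<open>f = c\<close>, where \<open>c 1 = c 2 = 1\<close>, this shows
  that \<open>c\<close> lies in \<open>\<int>[\<alpha>, \<beta>, I]\<close>; applied to the Somos 5 sequence it then gives the claim
  (\<open>somos5_strong_laurent\<close>). No divisibility or coprimality of polynomials enters.

  The argument divides by terms of the sequences, so it is carried out in the field of rational
  functions in the initial data, where no term vanishes. This nonvanishing is checked by
  specialisation to a degenerate curve, where sigma is the identity function and both sequences are
  explicit arithmetic progressions (for \<open>c\<close> with the terms of even index halved). The results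
  are transported to complex numbers by evaluation, which is defined at all terms because they are
  Laurent polynomials; for the terms of index below \<open>1\<close> one uses the reversed sequence.
\<close>

section \<open>The recurrence and its invariant\<close>

definition somos5_rel :: "'a::field \<Rightarrow> 'a \<Rightarrow> ('i::semiring_1 \<Rightarrow> 'a) \<Rightarrow> 'i \<Rightarrow> bool" where
  "somos5_rel \<alpha> \<beta> f n \<longleftrightarrow>
     f (n + 5) * f n = \<alpha> * f (n + 4) * f (n + 1) + \<beta> * f (n + 3) * f (n + 2)"

text \<open>
  The invariant in a form free of denominators. In terms of \<open>u n = f (n + 1) f (n - 2) / (f n f (n - 1))\<close>
  it reads \<open>u (n + 4) + u (n + 2) = J - u (n + 3) - \<alpha> / u (n + 3)\<close>, which does not involve
  \<open>\<beta>\<close> and still makes sense for a sequence that has a zero term.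
\<close>

definition somos5_inv :: "'a::field \<Rightarrow> 'a \<Rightarrow> ('i::semiring_1 \<Rightarrow> 'a) \<Rightarrow> 'i \<Rightarrow> bool" where
  "somos5_inv \<alpha> J f n \<longleftrightarrow>
     f (n + 5) * (f (n + 2))\<^sup>2 * f (n + 1) + f (n + 4) * (f (n + 3))\<^sup>2 * f n
     = J * f (n + 4) * f (n + 3) * f (n + 2) * f (n + 1)
       - (f (n + 4) * f (n + 1))\<^sup>2 - \<alpha> * (f (n + 3) * f (n + 2))\<^sup>2"

text \<open>
  Multiplying the invariant relation for \<open>F0, \<dots>, F5\<close> by \<open>F5\<close> and that for \<open>F1, \<dots>, F6\<close> by \<open>F1\<close>, the
  recurrence eliminates \<open>F0\<close> and \<open>F6\<close>, and both become the same relation in \<open>F1, \<dots>, F5\<close>. So the relation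
  propagates in either direction past nonzero terms.
\<close>

lemma invariant_shift:
  fixes F0 F1 F2 F3 F4 F5 F6 :: "'a::field"
  assumes "F5 * F0 = \<alpha> * F4 * F1 + \<beta> * F3 * F2"
    and "F6 * F1 = \<alpha> * F5 * F2 + \<beta> * F4 * F3"
  shows "F5 * (F5 * F2\<^sup>2 * F1 + F4 * F3\<^sup>2 * F0
             - (J * F4 * F3 * F2 * F1 - (F4 * F1)\<^sup>2 - \<alpha> * (F3 * F2)\<^sup>2))
       = F1 * (F6 * F3\<^sup>2 * F2 + F5 * F4\<^sup>2 * F1
             - (J * F5 * F4 * F3 * F2 - (F5 * F2)\<^sup>2 - \<alpha> * (F4 * F3)\<^sup>2))"
    (is "?L = ?R")
proof -
  have "?L = ?R + F4 * F3\<^sup>2 * (F5 * F0 - (\<alpha> * F4 * F1 + \<beta> * F3 * F2))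
     - F3\<^sup>2 * F2 * (F6 * F1 - (\<alpha> * F5 * F2 + \<beta> * F4 * F3))"
    by (simp add: algebra_simps power2_eq_square)
  then show ?thesis using assms by simp
qed

lemma invariant_as_J:
  fixes F0 F1 F2 F3 F4 F5 :: "'a::field"
  assumes "F5 * F0 = \<alpha> * F4 * F1 + \<beta> * F3 * F2"
    and "F1 \<noteq> 0" "F2 \<noteq> 0" "F3 \<noteq> 0" "F4 \<noteq> 0" "F5 \<noteq> 0"
  shows "F5 * F2\<^sup>2 * F1 + F4 * F3\<^sup>2 * F0
           = J * F4 * F3 * F2 * F1 - (F4 * F1)\<^sup>2 - \<alpha> * (F3 * F2)\<^sup>2
     \<longleftrightarrow> F4 * F1 / (F3 * F2) + F5 * F2 / (F4 * F3)
         + \<alpha> * (F3 * F2 / (F4 * F1) + F4 * F3 / (F5 * F2)) + \<beta> * (F3\<^sup>2 / (F5 * F1)) = J"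
    (is "?C \<longleftrightarrow> ?Q = J")
proof -
  \<comment> \<open>Here \<open>?N / ?D\<close> is \<open>?Q\<close> over a common denominator, and \<open>?N = J * ?D\<close> is the relation in
    \<open>F1, \<dots>, F5\<close> that is left of \<open>F5\<close> times \<open>?C\<close> after elimination of \<open>F0\<close>.\<close>
  let ?N = "(F4 * F1)\<^sup>2 * F5 + F5\<^sup>2 * F2\<^sup>2 * F1 + \<alpha> * (F3\<^sup>2 * F2\<^sup>2 * F5 + F4\<^sup>2 * F3\<^sup>2 * F1)
     + \<beta> * F3 ^ 3 * F2 * F4"
  let ?D = "F1 * F2 * F3 * F4 * F5"
  have D: "?D \<noteq> 0" using assms by simp
  have "?Q * ?D = ?N"
    using assms(2-) by (simp add: field_simps power2_eq_square power3_eq_cube)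
  then have "?Q = J \<longleftrightarrow> ?N = J * ?D"
    using D by (metis mult_right_cancel)
  moreover have "?N - J * ?D = F5 * (F5 * F2\<^sup>2 * F1 + F4 * F3\<^sup>2 * F0
       - (J * F4 * F3 * F2 * F1 - (F4 * F1)\<^sup>2 - \<alpha> * (F3 * F2)\<^sup>2))
     - F4 * F3\<^sup>2 * (F5 * F0 - (\<alpha> * F4 * F1 + \<beta> * F3 * F2))"
    by (simp add: algebra_simps power2_eq_square power3_eq_cube)
  ultimately show ?thesis
    using assms(1,6) by (metis (no_types, lifting) diff_self eq_iff_diff_eq_0 mult_eq_0_iff mult_zero_right diff_zero)
qed

lemma somos5_J_eq_iff_inv:
  fixes f :: "int \<Rightarrow> 'a::field"
  assumes "somos5_rel \<alpha> \<beta> f n"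
    and "f (n + 1) \<noteq> 0" "f (n + 2) \<noteq> 0" "f (n + 3) \<noteq> 0" "f (n + 4) \<noteq> 0" "f (n + 5) \<noteq> 0"
  shows "somos5_J \<alpha> \<beta> f (n + 3) = J \<longleftrightarrow> somos5_inv \<alpha> J f n"
  using invariant_as_J[of "f (n + 5)" "f n" \<alpha> "f (n + 4)" "f (n + 1)" \<beta> "f (n + 3)" "f (n + 2)" J]
    assms
  by (simp add: somos5_J_def somos5_rel_def somos5_inv_def add.commute)

lemma somos5_inv_shift_iff:
  fixes f :: "'i::semiring_1 \<Rightarrow> 'a::field"
  assumes "somos5_rel \<alpha> \<beta> f n" "somos5_rel \<alpha> \<beta> f (n + 1)"
  shows "f (n + 5) = 0 \<or> somos5_inv \<alpha> J f n \<longleftrightarrow> f (n + 1) = 0 \<or> somos5_inv \<alpha> J f (n + 1)"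
proof -
  have [simp]: "n + 1 + 1 = n + 2" "n + 1 + 2 = n + 3" "n + 1 + 3 = n + 4"
    "n + 1 + 4 = n + 5"
    by (simp_all add: add.assoc)
  show ?thesis
    using invariant_shift[of "f (n + 5)" "f n" \<alpha> "f (n + 4)" "f (n + 1)" \<beta> "f (n + 3)" "f (n + 2)"
        "f (n + 1 + 5)" J] assms
    unfolding somos5_rel_def somos5_inv_def
    by (simp add: mult.assoc) (metis (no_types, lifting) eq_iff_diff_eq_0 mult_eq_0_iff)
qed

section \<open>The companion sequence and the addition formula\<close>

text \<open>
  The induction step of the addition formula. With \<open>X = F4 F1\<close> and \<open>Y = F3 F2\<close> both sides are quadratic
  forms in \<open>X\<close> and \<open>Y\<close>: on the left the recurrence for \<open>F\<close> handles the product \<open>F5 F2 F3 F0\<close>, and the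
  invariant for \<open>F\<close> handles the mixed terms. The coefficients of \<open>X\<^sup>2\<close> agree trivially, those of \<open>Y\<^sup>2\<close> by the
  recurrence for \<open>C\<close>, and those of \<open>X Y\<close> by the invariant for \<open>C\<close>.
\<close>

lemma addition_step:
  fixes F0 F1 F2 F3 F4 F5 C0 C1 C2 C3 C4 C5 :: "'a::field"
  assumes "F5 * F0 = \<alpha> * F4 * F1 + \<beta> * F3 * F2"
    and "C5 * C0 = \<alpha> * C4 * C1 + \<beta> * C3 * C2"
    and "F5 * F2\<^sup>2 * F1 + F4 * F3\<^sup>2 * F0
           = J * F4 * F3 * F2 * F1 - (F4 * F1)\<^sup>2 - \<alpha> * (F3 * F2)\<^sup>2"
    and "C5 * C2\<^sup>2 * C1 + C4 * C3\<^sup>2 * C0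
           = J * C4 * C3 * C2 * C1 - (C4 * C1)\<^sup>2 - \<alpha> * (C3 * C2)\<^sup>2"
  shows "(C3 * C2 * (F5 * F2) - C4 * C1 * (F4 * F3)) * (C3 * C2 * (F3 * F0) - C4 * C1 * (F2 * F1))
       = (C4 * C3 * (F4 * F1) - C5 * C2 * (F3 * F2)) * (C2 * C1 * (F4 * F1) - C3 * C0 * (F3 * F2))"
    (is "?L = ?R")
proof -
  have "?L = ?R
     + C3\<^sup>2 * C2\<^sup>2 * F3 * F2 * (F5 * F0 - (\<alpha> * F4 * F1 + \<beta> * F3 * F2))
     - C3 * C2 * (F3 * F2)\<^sup>2 * (C5 * C0 - (\<alpha> * C4 * C1 + \<beta> * C3 * C2))
     - C4 * C3 * C2 * C1 * (F5 * F2\<^sup>2 * F1 + F4 * F3\<^sup>2 * F0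
         - (J * F4 * F3 * F2 * F1 - (F4 * F1)\<^sup>2 - \<alpha> * (F3 * F2)\<^sup>2))
     + F4 * F3 * F2 * F1 * (C5 * C2\<^sup>2 * C1 + C4 * C3\<^sup>2 * C0
         - (J * C4 * C3 * C2 * C1 - (C4 * C1)\<^sup>2 - \<alpha> * (C3 * C2)\<^sup>2))"
    by (simp add: algebra_simps power2_eq_square)
  then show ?thesis using assms by simp
qed

text \<open>
  The fifth term is not determined by the recurrence, which holds at \<open>n = 0\<close> whatever it is because
  the term of index \<open>0\<close> vanishes. It is the value that gives the sequence the invariant \<open>J\<close> when
  \<open>I = \<beta> + \<alpha> J\<close>.
\<close>

fun companion :: "'a::field \<Rightarrow> 'a \<Rightarrow> 'a \<Rightarrow> nat \<Rightarrow> 'a" where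
  "companion \<alpha> \<beta> I n =
     (if n = 0 then 0 else if n \<le> 2 then 1 else if n = 3 then \<alpha> else if n = 4 then - \<beta>
      else if n = 5 then - (\<alpha> * \<alpha> * \<alpha> + \<beta> * I)
      else (\<alpha> * companion \<alpha> \<beta> I (n - 1) * companion \<alpha> \<beta> I (n - 4)
            + \<beta> * companion \<alpha> \<beta> I (n - 2) * companion \<alpha> \<beta> I (n - 3)) / companion \<alpha> \<beta> I (n - 5))"

declare companion.simps [simp del]

lemma companion_initial [simp]:
  "companion \<alpha> \<beta> I 0 = 0" "companion \<alpha> \<beta> I 1 = 1" "companion \<alpha> \<beta> I (Suc 0) = 1"
  "companion \<alpha> \<beta> I 2 = 1" "companion \<alpha> \<beta> I (Suc (Suc 0)) = 1"
  "companion \<alpha> \<beta> I 3 = \<alpha>" "companion \<alpha> \<beta> I 4 = - \<beta>"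
  "companion \<alpha> \<beta> I 5 = - (\<alpha> * \<alpha> * \<alpha> + \<beta> * I)"
  by (simp_all add: companion.simps)

lemma companion_rec:
  assumes "n \<ge> 1"
  shows "companion \<alpha> \<beta> I (n + 5) =
    (\<alpha> * companion \<alpha> \<beta> I (n + 4) * companion \<alpha> \<beta> I (n + 1)
      + \<beta> * companion \<alpha> \<beta> I (n + 3) * companion \<alpha> \<beta> I (n + 2)) / companion \<alpha> \<beta> I n"
  using assms by (subst companion.simps) (simp add: add.commute)

lemma companion_somos5_rel:
  assumes "n \<ge> 1 \<Longrightarrow> companion \<alpha> \<beta> I n \<noteq> 0"
  shows "somos5_rel \<alpha> \<beta> (companion \<alpha> \<beta> I) n"
proof (cases "n = 0")
  case True
  then show ?thesis by (simp add: somos5_rel_def)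
next
  case False
  then show ?thesis
    using assms companion_rec[of n \<alpha> \<beta> I] by (simp add: somos5_rel_def)
qed

text \<open>
  At \<open>n = 0\<close> this is the choice of the fifth term. The shift from \<open>n\<close> to \<open>n + 1\<close> divides by the term
  of index \<open>n + 1\<close> only, so the zero at index \<open>0\<close> does no harm.
\<close>

lemma companion_somos5_inv:
  assumes nz: "\<And>n. n \<ge> 1 \<Longrightarrow> companion \<alpha> \<beta> (\<beta> + \<alpha> * J) n \<noteq> 0"
  shows "somos5_inv \<alpha> J (companion \<alpha> \<beta> (\<beta> + \<alpha> * J)) n"
proof (induction n)
  case 0
  then show ?case
    by (simp add: somos5_inv_def algebra_simps power2_eq_square)
next
  case (Suc n)
  then show ?case
    using somos5_inv_shift_iff[OF companion_somos5_rel companion_somos5_rel, of n \<alpha> \<beta> "\<beta> + \<alpha> * J" J] nz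
    by simp
qed

text \<open>
  Let \<open>P j k\<close> be the left-hand side. Rearranging the four factors,
  \<open>P (j + 2) k P j (k + 2) = P (j + 1) (k + 2) P (j + 1) k\<close>, which gives \<open>P (j + 2) k\<close> by division. The
  divisor has the indices \<open>k + 2\<close> and \<open>k + 2 j + 5\<close>; restricting to \<open>k \<ge> 1\<close> keeps all indices positive,
  so that the formula applies to \<open>f = c\<close> despite \<open>c 0 = 0\<close>.
\<close>

lemma addition_formula:
  fixes f c :: "nat \<Rightarrow> 'a::field"
  assumes c1: "c 1 = 1" and c2: "c 2 = 1" and c3: "c 3 = \<alpha>" and c4: "c 4 = - \<beta>" and c0: "c 0 = 0"
    and c_rel: "\<And>n. somos5_rel \<alpha> \<beta> c n" and c_inv: "\<And>n. somos5_inv \<alpha> J c n"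
    and f_rel: "\<And>n. n \<ge> 1 \<Longrightarrow> somos5_rel \<alpha> \<beta> f n"
    and f_inv: "\<And>n. n \<ge> 1 \<Longrightarrow> somos5_inv \<alpha> J f n"
    and nz: "\<And>n. n \<ge> 1 \<Longrightarrow> f n \<noteq> 0"
    and "k \<ge> 1"
  shows "f (k + 2 * j + 3) * f k = c (j + 2) * c (j + 1) * (f (k + j + 3) * f (k + j))
           - c (j + 3) * c j * (f (k + j + 2) * f (k + j + 1))"
  using \<open>k \<ge> 1\<close>
proof (induction j arbitrary: k rule: induct_nat_012)
  case 0
  then show ?case using c0 c1 c2 by (simp flip: numeral_2_eq_2)
next
  case 1
  then show ?case
    using f_rel[of k] c1 c2 c3 c4
    by (simp add: somos5_rel_def numeral_eq_Suc mult.assoc)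
next
  case (ge2 j)
  have cancel: "u * x = w" if "u * v * (y * x) = w * (y * v)" "y * v \<noteq> 0" for u v w x y :: 'a
  proof -
    have "(u * x) * (y * v) = w * (y * v)" using that(1) by (simp only: mult_ac)
    with that(2) show ?thesis by simp
  qed
  define n where "n = k + j + 1"
  have P: "f (k + 2 * j + 5) * f (k + 2)
      = c (j + 2) * c (j + 1) * (f (n + 4) * f (n + 1))
        - c (j + 3) * c j * (f (n + 3) * f (n + 2))"
    using ge2.IH(1)[of "k + 2"] by (simp add: n_def algebra_simps numeral_eq_Suc)
  have Q: "f (k + 2 * j + 5) * f k
      = c (j + 3) * c (j + 2) * (f (n + 3) * f n)
        - c (j + 4) * c (j + 1) * (f (n + 2) * f (n + 1))"
    using ge2.IH(2)[of k] ge2.prems by (simp add: n_def algebra_simps numeral_eq_Suc)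
  have R: "f (k + 2 * j + 7) * f (k + 2)
      = c (j + 3) * c (j + 2) * (f (n + 5) * f (n + 2))
        - c (j + 4) * c (j + 1) * (f (n + 4) * f (n + 3))"
    using ge2.IH(2)[of "k + 2"] by (simp add: n_def algebra_simps numeral_eq_Suc)
  have "n \<ge> 1" using ge2.prems by (simp add: n_def)
  from addition_step[OF
      f_rel[OF this, unfolded somos5_rel_def] c_rel[of j, unfolded somos5_rel_def]
      f_inv[OF this, unfolded somos5_inv_def] c_inv[of j, unfolded somos5_inv_def]]
  have "f (k + 2 * j + 7) * f (k + 2) * (f (k + 2 * j + 5) * f k)
      = (c (j + 4) * c (j + 3) * (f (n + 4) * f (n + 1)) - c (j + 5) * c (j + 2) * (f (n + 3) * f (n + 2)))
        * (f (k + 2 * j + 5) * f (k + 2))"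
    unfolding P Q R .
  moreover have "f (k + 2 * j + 5) * f (k + 2) \<noteq> 0"
    using nz by simp
  ultimately have "f (k + 2 * j + 7) * f k
      = c (j + 4) * c (j + 3) * (f (n + 4) * f (n + 1)) - c (j + 5) * c (j + 2) * (f (n + 3) * f (n + 2))"
    by (rule cancel)
  then show ?case
    by (simp add: n_def algebra_simps numeral_eq_Suc)
qed

section \<open>The Laurent property\<close>

definition unital_subring :: "'a::comm_ring_1 set \<Rightarrow> bool" where
  "unital_subring A \<longleftrightarrow> 1 \<in> A \<and> (\<forall>x\<in>A. \<forall>y\<in>A. x - y \<in> A \<and> x * y \<in> A)"

lemma unital_subringD:
  assumes "unital_subring A"
  shows "1 \<in> A" "0 \<in> A" "x \<in> A \<Longrightarrow> y \<in> A \<Longrightarrow> x - y \<in> A" "x \<in> A \<Longrightarrow> y \<in> A \<Longrightarrow> x * y \<in> A"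
    "x \<in> A \<Longrightarrow> - x \<in> A" "x \<in> A \<Longrightarrow> y \<in> A \<Longrightarrow> x + y \<in> A"
proof -
  show 1: "1 \<in> A" and minus: "x \<in> A \<Longrightarrow> y \<in> A \<Longrightarrow> x - y \<in> A" for x y
    using assms by (auto simp: unital_subring_def)
  show "x \<in> A \<Longrightarrow> y \<in> A \<Longrightarrow> x * y \<in> A"
    using assms by (auto simp: unital_subring_def)
  show 0: "0 \<in> A" using minus[OF 1 1] by simp
  show neg: "x \<in> A \<Longrightarrow> - x \<in> A" for x using minus[OF 0, of x] by simp
  show "x \<in> A \<Longrightarrow> y \<in> A \<Longrightarrow> x + y \<in> A" using minus[OF _ neg, of x y] by simp
qed

text \<open>
  An index \<open>n > 5\<close> is \<open>k + 2 j + 3\<close> with \<open>k = 1\<close> or \<open>k = 2\<close>, according to its parity, and \<open>j \<ge> 1\<close>; all other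
  indices in the addition formula are then below \<open>n\<close>. The hypothesis on \<open>c\<close> asks for no more than the terms
  below \<open>n\<close> and the initial ones, so that the lemma can serve as induction step in the case \<open>f = c\<close>.
\<close>

lemma addition_formula_closure:
  fixes f c :: "nat \<Rightarrow> 'a::field"
  assumes A: "unital_subring A"
    and add: "\<And>j k. k \<ge> 1 \<Longrightarrow>
      f (k + 2 * j + 3) * f k = c (j + 2) * c (j + 1) * (f (k + j + 3) * f (k + j))
           - c (j + 3) * c j * (f (k + j + 2) * f (k + j + 1))"
    and c: "\<And>m. m < n \<or> 1 \<le> m \<and> m \<le> 5 \<Longrightarrow> c m \<in> A"
    and init: "f 1 \<in> A" "f 2 \<in> A" "f 3 \<in> A" "f 4 \<in> A" "f 5 \<in> A"
    and unit: "f 1 \<noteq> 0" "f 2 \<noteq> 0" "inverse (f 1) \<in> A" "inverse (f 2) \<in> A"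
    and "n \<ge> 1"
  shows "f n \<in> A"
  using c \<open>n \<ge> 1\<close>
proof (induction n rule: less_induct)
  case (less n)
  show ?case
  proof (cases "n \<le> 5")
    case True
    then have "n = 1 \<or> n = 2 \<or> n = 3 \<or> n = 4 \<or> n = 5" using less.prems by linarith
    then show ?thesis using init by auto
  next
    case False
    define k :: nat where "k = (if even n then 1 else 2)"
    define j where "j = (n - 3 - k) div 2"
    have n: "n = k + 2 * j + 3" and j: "j \<ge> 1"
      using False by (auto simp: k_def j_def elim!: evenE oddE)
    have k: "k \<ge> 1" "k \<le> 2" "f k \<noteq> 0" "inverse (f k) \<in> A" using unit by (auto simp: k_def)
    have fA: "f i \<in> A" if "i \<ge> 1" "i \<le> k + j + 3" for i
      using less.IH[of i] less.prems(1) that n j by force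
    have cA: "c i \<in> A" if "i \<le> j + 3" for i
      using less.prems(1)[of i] that n k(1) j by simp
    have "f n * f k \<in> A"
      unfolding n add[OF k(1)] using fA cA k by (intro unital_subringD[OF A]) auto
    then have "f n * f k * inverse (f k) \<in> A"
      using k(4) by (rule unital_subringD[OF A])
    then show ?thesis using k(3) by (simp add: mult.assoc)
  qed
qed

text \<open>
  Stated for an arbitrary subring \<open>A\<close> of a field instead of the ring generated by the data, so that
  \<open>A\<close> can also be the ring of rational functions that can be evaluated at a given point.
\<close>

lemma somos5_strong_laurent:
  fixes f :: "nat \<Rightarrow> 'a::field"
  assumes A: "unital_subring A" "\<alpha> \<in> A" "\<beta> \<in> A" "\<beta> + \<alpha> * J \<in> A"
    and c_nz: "\<And>n. n \<ge> 1 \<Longrightarrow> companion \<alpha> \<beta> (\<beta> + \<alpha> * J) n \<noteq> 0"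
    and f_rel: "\<And>n. n \<ge> 1 \<Longrightarrow> somos5_rel \<alpha> \<beta> f n"
    and f_inv: "\<And>n. n \<ge> 1 \<Longrightarrow> somos5_inv \<alpha> J f n"
    and nz: "\<And>n. n \<ge> 1 \<Longrightarrow> f n \<noteq> 0"
    and init: "f 1 \<in> A" "f 2 \<in> A" "f 3 \<in> A" "f 4 \<in> A" "f 5 \<in> A"
    and unit: "inverse (f 1) \<in> A" "inverse (f 2) \<in> A"
    and "n \<ge> 1"
  shows "f n \<in> A"
proof -
  define c where "c = companion \<alpha> \<beta> (\<beta> + \<alpha> * J)"
  have c_rel: "somos5_rel \<alpha> \<beta> c m" and c_inv: "somos5_inv \<alpha> J c m" for m
    unfolding c_def by (rule companion_somos5_rel companion_somos5_inv, erule c_nz)+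
  have [simp]: "c 0 = 0" "c 1 = 1" "c (Suc 0) = 1" "c 2 = 1" "c 3 = \<alpha>" "c 4 = - \<beta>"
    "c 5 = - (\<alpha> * \<alpha> * \<alpha> + \<beta> * (\<beta> + \<alpha> * J))"
    by (simp_all add: c_def)
  note ring = unital_subringD[OF A(1)]
  have c_init: "c 0 \<in> A" "c 1 \<in> A" "c 2 \<in> A" "c 3 \<in> A" "c 4 \<in> A" "c 5 \<in> A"
    using A by (simp_all add: ring del: minus_add_distrib)
  \<comment> \<open>The addition formula for \<open>c\<close> itself, where the divisors are \<open>c 1 = c 2 = 1\<close>.\<close>
  have cA: "c m \<in> A" for m
  proof (induction m rule: less_induct)
    case (less m)
    have small: "c i \<in> A" if "i < m \<or> 1 \<le> i \<and> i \<le> 5" for i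
    proof (cases "i < m")
      case False
      with that have "i = 1 \<or> i = 2 \<or> i = 3 \<or> i = 4 \<or> i = 5" by linarith
      then show ?thesis using c_init by auto
    qed (rule less.IH)
    show ?case
    proof (cases "m = 0")
      case False
      then show ?thesis
        using c_init c_nz small ring(1)
        by (intro addition_formula_closure[where f = c and c = c and n = m, OF A(1)]
              addition_formula[where J = J and \<alpha> = \<alpha> and \<beta> = \<beta>])
           (auto simp: c_rel c_inv simp flip: c_def)
    qed (use c_init in simp)
  qed
  show ?thesis
    using init unit nz \<open>n \<ge> 1\<close>
    by (intro addition_formula_closure[where f = f and c = c and n = n, OF A(1)]
          addition_formula[where J = J and \<alpha> = \<alpha> and \<beta> = \<beta>])
       (auto simp: c_rel c_inv cA f_rel f_inv)
qed

section \<open>Evaluation of rational functions\<close>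

text \<open>
  The graph of \<open>rat_value x\<close>, restricted to the rational functions that are regular at \<open>x\<close>. As a
  relation it carries the information that the value exists, and it is preserved by the field
  operations.
\<close>

definition takes_value :: "(int \<Rightarrow> 'a::field) \<Rightarrow> int_mpoly fract \<Rightarrow> 'a \<Rightarrow> bool" where
  "takes_value x r v \<longleftrightarrow>
     (\<exists>p q. mpoly_eval x q \<noteq> 0 \<and> r = Fract p q \<and> v = mpoly_eval x p / mpoly_eval x q)"

lemma rat_value_eqI: "takes_value x r v \<Longrightarrow> rat_value x r = v"
  by (auto simp: takes_value_def rat_value_Fract)

lemma takes_value_nonzero: "takes_value x r v \<Longrightarrow> v \<noteq> 0 \<Longrightarrow> r \<noteq> 0"
proof
  assume r: "takes_value x r v" "v \<noteq> 0" "r = 0"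
  have "takes_value x 0 0"
    unfolding takes_value_def Zero_fract_def by (intro exI[of _ 0] exI[of _ 1]) simp
  then show False using r rat_value_eqI by metis
qed

lemma takes_value_indet: "takes_value x (indet i) (x i)"
  unfolding takes_value_def indet_def
  by (intro exI[of _ "Poly_Mapping.single (Poly_Mapping.single i 1) 1"] exI[of _ 1])
     (simp add: mpoly_eval_single)

lemma takes_value_1: "takes_value x 1 1"
  unfolding takes_value_def One_fract_def by (intro exI[of _ 1]) simp

lemma mpoly_eval_minus: "mpoly_eval x (- p) = - mpoly_eval x p"
  using mpoly_eval_add[of x p "- p"] by (simp add: eq_neg_iff_add_eq_0 add.commute)

lemma takes_value_uminus: "takes_value x r v \<Longrightarrow> takes_value x (- r) (- v)"
  unfolding takes_value_def by (metis minus_fract mpoly_eval_minus minus_divide_left)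

lemma takes_value_add:
  assumes "takes_value x r v" "takes_value x r' v'"
  shows "takes_value x (r + r') (v + v')"
proof -
  obtain p q p' q' where *: "mpoly_eval x q \<noteq> 0" "r = Fract p q" "v = mpoly_eval x p / mpoly_eval x q"
    "mpoly_eval x q' \<noteq> 0" "r' = Fract p' q'" "v' = mpoly_eval x p' / mpoly_eval x q'"
    using assms unfolding takes_value_def by blast
  then have "q \<noteq> 0" "q' \<noteq> 0" by auto
  then show ?thesis
    unfolding takes_value_def using *
    by (intro exI[of _ "p * q' + p' * q"] exI[of _ "q * q'"])
       (simp add: mpoly_eval_mult mpoly_eval_add add_frac_eq)
qed

lemma takes_value_diff:
  "takes_value x r v \<Longrightarrow> takes_value x r' v' \<Longrightarrow> takes_value x (r - r') (v - v')"
  using takes_value_add[of x r v "- r'" "- v'"] takes_value_uminus[of x r' v'] by simp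

lemma takes_value_mult:
  assumes "takes_value x r v" "takes_value x r' v'"
  shows "takes_value x (r * r') (v * v')"
proof -
  obtain p q p' q' where *: "mpoly_eval x q \<noteq> 0" "r = Fract p q" "v = mpoly_eval x p / mpoly_eval x q"
    "mpoly_eval x q' \<noteq> 0" "r' = Fract p' q'" "v' = mpoly_eval x p' / mpoly_eval x q'"
    using assms unfolding takes_value_def by blast
  then show ?thesis
    unfolding takes_value_def
    by (intro exI[of _ "p * p'"] exI[of _ "q * q'"]) (simp add: mpoly_eval_mult)
qed

lemma takes_value_divide:
  assumes "takes_value x r v" "takes_value x r' v'" "v' \<noteq> 0"
  shows "takes_value x (r / r') (v / v')"
proof -
  obtain p q p' q' where *: "mpoly_eval x q \<noteq> 0" "r = Fract p q" "v = mpoly_eval x p / mpoly_eval x q"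
    "mpoly_eval x q' \<noteq> 0" "r' = Fract p' q'" "v' = mpoly_eval x p' / mpoly_eval x q'"
    using assms unfolding takes_value_def by blast
  then show ?thesis
    unfolding takes_value_def using assms(3)
    by (intro exI[of _ "p * q'"] exI[of _ "q * p'"]) (auto simp: mpoly_eval_mult)
qed

lemmas takes_value_ops =
  takes_value_1 takes_value_add takes_value_uminus takes_value_mult takes_value_divide

lemma takes_value_inverse:
  "takes_value x r v \<Longrightarrow> v \<noteq> 0 \<Longrightarrow> takes_value x (inverse r) (inverse v)"
  using takes_value_divide[OF takes_value_1, of x r v] by (simp add: inverse_eq_divide)

lemma takes_value_somos5_J:
  assumes "takes_value x \<alpha> a" "takes_value x \<beta> b"
    and "\<And>k. k \<in> {n - 2..n + 2} \<Longrightarrow> takes_value x (s k) (\<tau> k)"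
    and "\<tau> (n - 2) \<noteq> 0" "\<tau> (n - 1) \<noteq> 0" "\<tau> n \<noteq> 0" "\<tau> (n + 1) \<noteq> 0" "\<tau> (n + 2) \<noteq> 0"
  shows "takes_value x (somos5_J \<alpha> \<beta> s n) (somos5_J a b \<tau> n)"
  unfolding somos5_J_def power2_eq_square using assms
  by (intro takes_value_ops) auto

lemma unital_subring_takes_value:
  assumes "unital_subring B"
  shows "unital_subring {r. \<exists>v\<in>B. takes_value x r v}"
  unfolding unital_subring_def
proof (intro conjI ballI)
  show "1 \<in> {r. \<exists>v\<in>B. takes_value x r v}"
    using unital_subringD(1)[OF assms] takes_value_1 by blast
  fix r r' assume "r \<in> {r. \<exists>v\<in>B. takes_value x r v}" "r' \<in> {r. \<exists>v\<in>B. takes_value x r v}"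
  then obtain v v' where v: "v \<in> B" "v' \<in> B" "takes_value x r v" "takes_value x r' v'" by blast
  show "r - r' \<in> {r. \<exists>v\<in>B. takes_value x r v}"
    using takes_value_diff[OF v(3,4)] unital_subringD(3)[OF assms v(1,2)] by blast
  show "r * r' \<in> {r. \<exists>v\<in>B. takes_value x r v}"
    using takes_value_mult[OF v(3,4)] unital_subringD(4)[OF assms v(1,2)] by blast
qed

text \<open>
  A specialisation that is never zero shows at every step that the next denominator does not vanish
  at \<open>x\<close>.
\<close>

lemma takes_value_recurrence:
  fixes f :: "nat \<Rightarrow> int_mpoly fract" and g :: "nat \<Rightarrow> 'a::field"
  assumes "takes_value x \<alpha> a" "takes_value x \<beta> b"
    and f: "\<And>n. n \<ge> 1 \<Longrightarrow> f (n + 5) =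
      (\<alpha> * f (n + 4) * f (n + 1) + \<beta> * f (n + 3) * f (n + 2)) / f n"
    and g: "\<And>n. n \<ge> 1 \<Longrightarrow> somos5_rel a b g n" "\<And>n. n \<ge> 1 \<Longrightarrow> g n \<noteq> 0"
    and init: "\<And>n. n \<in> {1, 2, 3, 4, 5} \<Longrightarrow> takes_value x (f n) (g n)"
    and "n \<ge> 1"
  shows "takes_value x (f n) (g n)"
  using \<open>n \<ge> 1\<close>
proof (induction n rule: less_induct)
  case (less n)
  show ?case
  proof (cases "n \<le> 5")
    case True
    then have "n \<in> {1, 2, 3, 4, 5}" using less.prems by auto
    then show ?thesis by (rule init)
  next
    case False
    define m where "m = n - 5"
    have m: "n = m + 5" "m \<ge> 1" using False by (auto simp: m_def)
    have "g n = (a * g (m + 4) * g (m + 1) + b * g (m + 3) * g (m + 2)) / g m"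
      using g(1)[OF m(2)] g(2)[OF m(2)] m(1) by (simp add: somos5_rel_def eq_divide_eq)
    moreover have "takes_value x (f n)
        ((a * g (m + 4) * g (m + 1) + b * g (m + 3) * g (m + 2)) / g m)"
      unfolding m(1) f[OF m(2)] using m assms(1,2) g(2)[OF m(2)]
      by (intro takes_value_ops less.IH) auto
    ultimately show ?thesis by simp
  qed
qed

section \<open>The formal Somos 5 sequence\<close>

lemma somos5_formal_forward:
  assumes "n \<ge> 1"
  shows "somos5_formal (n + 5) =
    (indet_alpha * somos5_formal (n + 4) * somos5_formal (n + 1)
      + indet_beta * somos5_formal (n + 3) * somos5_formal (n + 2)) / somos5_formal n"
  using assms by (subst somos5_formal.simps) (simp add: add.commute)

lemma somos5_formal_backward:
  assumes "n \<le> 0"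
  shows "somos5_formal n =
    (indet_alpha * somos5_formal (n + 4) * somos5_formal (n + 1)
      + indet_beta * somos5_formal (n + 3) * somos5_formal (n + 2)) / somos5_formal (n + 5)"
  using assms by (subst somos5_formal.simps) simp

lemma somos5_formal_initial: "n \<in> {1..5} \<Longrightarrow> somos5_formal n = indet n"
  by (subst somos5_formal.simps) auto

text \<open>
  Where the curve degenerates to a cusp, the sigma function is \<open>z \<mapsto> z\<close>, and arithmetic progressions
  satisfy the recurrence with \<open>\<alpha> = 3\<close>, \<open>\<beta> = - 2\<close>. Starting the progression at an odd multiple of half
  its step avoids the zero for all integer indices.
\<close>

definition degenerate_seq :: "int \<Rightarrow> rat" where
  "degenerate_seq n = of_int (2 * n + 1)"

definition degenerate_point :: "int \<Rightarrow> rat" where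
  "degenerate_point = degenerate_seq(0 := 3, 6 := - 2)"

lemma degenerate_seq_nonzero: "degenerate_seq n \<noteq> 0"
proof -
  have "2 * n + 1 \<noteq> 0" by presburger
  then show ?thesis unfolding degenerate_seq_def by (metis of_int_eq_0_iff)
qed

lemma degenerate_seq_rel: "somos5_rel 3 (- 2) degenerate_seq n"
  by (simp add: somos5_rel_def degenerate_seq_def algebra_simps)

lemma takes_value_degenerate_coeffs:
  "takes_value degenerate_point indet_alpha 3" "takes_value degenerate_point indet_beta (- 2)"
  using takes_value_indet[of degenerate_point 0] takes_value_indet[of degenerate_point 6]
  by (simp_all add: degenerate_point_def)

lemma takes_value_degenerate_initial:
  "n \<in> {1..5} \<Longrightarrow> takes_value degenerate_point (somos5_formal n) (degenerate_seq n)"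
  using takes_value_indet[of degenerate_point n]
  by (simp add: somos5_formal_initial degenerate_point_def)

lemma takes_value_degenerate:
  "takes_value degenerate_point (somos5_formal n) (degenerate_seq n)"
proof (cases "n \<ge> 1")
  case True
  have "takes_value degenerate_point (somos5_formal (int m)) (degenerate_seq (int m))"
    if "m \<ge> 1" for m
  proof (rule takes_value_recurrence[OF takes_value_degenerate_coeffs _ _ _ _ that])
    fix m :: nat assume "m \<ge> 1"
    then show "somos5_formal (int (m + 5)) =
      (indet_alpha * somos5_formal (int (m + 4)) * somos5_formal (int (m + 1))
        + indet_beta * somos5_formal (int (m + 3)) * somos5_formal (int (m + 2))) / somos5_formal (int m)"
      using somos5_formal_forward[of "int m"] by (simp add: add.commute)
    show "somos5_rel 3 (- 2) (\<lambda>m. degenerate_seq (int m)) m"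
      using degenerate_seq_rel[of "int m"] by (simp add: somos5_rel_def add.commute)
  qed (auto intro!: takes_value_degenerate_initial simp: degenerate_seq_nonzero)
  from this[of "nat n"] True show ?thesis by simp
next
  case False
  have "takes_value degenerate_point (somos5_formal (6 - int m)) (degenerate_seq (6 - int m))"
    if "m \<ge> 1" for m
  proof (rule takes_value_recurrence[OF takes_value_degenerate_coeffs _ _ _ _ that])
    fix m :: nat assume "m \<ge> 1"
    then show "somos5_formal (6 - int (m + 5)) =
      (indet_alpha * somos5_formal (6 - int (m + 4)) * somos5_formal (6 - int (m + 1))
        + indet_beta * somos5_formal (6 - int (m + 3)) * somos5_formal (6 - int (m + 2)))
      / somos5_formal (6 - int m)"
      using somos5_formal_backward[of "1 - int m"] by (simp add: algebra_simps)
    show "somos5_rel 3 (- 2) (\<lambda>m. degenerate_seq (6 - int m)) m"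
      using degenerate_seq_rel[of "1 - int m"] by (simp add: somos5_rel_def algebra_simps)
  qed (auto intro!: takes_value_degenerate_initial simp: degenerate_seq_nonzero)
  from this[of "nat (6 - n)"] False show ?thesis by simp
qed

lemma somos5_formal_nonzero: "somos5_formal n \<noteq> 0"
  using takes_value_nonzero[OF takes_value_degenerate degenerate_seq_nonzero] .

lemma somos5_formal_rel: "somos5_rel indet_alpha indet_beta somos5_formal n"
proof (cases "n \<ge> 1")
  case True
  then show ?thesis
    unfolding somos5_rel_def
    by (subst somos5_formal_forward) (simp_all add: somos5_formal_nonzero)
next
  case False
  then show ?thesis
    unfolding somos5_rel_def
    by (subst somos5_formal_backward[of n]) (simp_all add: somos5_formal_nonzero)
qed

abbreviation J_formal :: "int_mpoly fract" where
  "J_formal \<equiv> somos5_J indet_alpha indet_beta somos5_formal 3"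

lemma somos5_formal_inv: "somos5_inv indet_alpha J_formal somos5_formal n"
proof (induction n rule: int_induct[where k = 0])
  case base
  show ?case
    using somos5_J_eq_iff_inv[OF somos5_formal_rel[of 0], of J_formal] by (simp add: somos5_formal_nonzero)
next
  case (step1 n)
  then show ?case
    using somos5_inv_shift_iff[OF somos5_formal_rel[of n] somos5_formal_rel]
    by (simp add: somos5_formal_nonzero)
next
  case (step2 n)
  then show ?case
    using somos5_inv_shift_iff[OF somos5_formal_rel[of "n - 1"] somos5_formal_rel]
    by (simp add: somos5_formal_nonzero)
qed

lemma somos5_formal_J_constant: "somos5_J indet_alpha indet_beta somos5_formal n = J_formal"
  using somos5_J_eq_iff_inv[OF somos5_formal_rel[of "n - 3"], of J_formal]
    somos5_formal_inv[of "n - 3"]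
  by (simp add: somos5_formal_nonzero)

text \<open>
  At the degenerate point \<open>J = 6\<close> and \<open>I = 16\<close>, and the companion sequence specialises to the
  progression that does start at zero, with the terms of even index halved: \<open>0, 1, 1, 3, 2, 5, 3, 7, 4, \<dots>\<close>.
\<close>

lemma companion_formal_nonzero:
  assumes "n \<ge> 1"
  shows "companion indet_alpha indet_beta (indet_beta + indet_alpha * J_formal) n \<noteq> 0"
proof -
  let ?x = degenerate_point
  let ?c = "companion indet_alpha indet_beta (indet_beta + indet_alpha * J_formal)"
  define d :: "nat \<Rightarrow> rat" where "d n = (if odd n then of_nat n else of_nat n / 2)" for n
  have "takes_value ?x J_formal (somos5_J 3 (- 2) degenerate_seq 3)"
    by (intro takes_value_somos5_J takes_value_degenerate_coeffs takes_value_degenerate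
          degenerate_seq_nonzero)
  moreover have "somos5_J 3 (- 2) degenerate_seq 3 = 6"
    by (simp add: somos5_J_def degenerate_seq_def)
  ultimately have J: "takes_value ?x J_formal 6" by simp
  have I: "takes_value ?x (indet_beta + indet_alpha * J_formal) (- 2 + 3 * 6)"
    by (intro takes_value_ops takes_value_degenerate_coeffs J)
  have "takes_value ?x (?c n) (d n)"
  proof (rule takes_value_recurrence[OF takes_value_degenerate_coeffs companion_rec _ _ _ assms])
    fix m :: nat
    show "somos5_rel 3 (- 2) d m"
      by (simp add: somos5_rel_def d_def field_simps)
    show "m \<ge> 1 \<Longrightarrow> d m \<noteq> 0" by (simp add: d_def)
    have 4: "takes_value ?x (- indet_beta) (- (- 2))"
      and 5: "takes_value ?x (- (indet_alpha * indet_alpha * indet_alpha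
        + indet_beta * (indet_beta + indet_alpha * J_formal))) (- (3 * 3 * 3 + - 2 * (- 2 + 3 * 6)))"
      by (intro takes_value_ops takes_value_degenerate_coeffs I)+
    show "m \<in> {1, 2, 3, 4, 5} \<Longrightarrow> takes_value ?x (?c m) (d m)"
      using 4 5 takes_value_degenerate_coeffs(1) takes_value_1
      by (auto simp: d_def simp del: minus_add_distrib)
  qed
  moreover have "d n \<noteq> 0" using assms by (simp add: d_def)
  ultimately show ?thesis by (rule takes_value_nonzero)
qed

section \<open>Passage to complex values\<close>

lemma unital_subring_int_adjoin: "unital_subring (int_adjoin S)"
proof -
  interpret ring "ring_of_type_algebra :: 'a ring" by (rule ring_from_type_algebra)
  have inv: "\<ominus>\<^bsub>ring_of_type_algebra\<^esub> x = - x" for x :: 'a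
    by (rule minus_equality) (simp_all add: ring_of_type_algebra_def)
  have "1 \<in> int_adjoin S"
    using generate_ring.one[of ring_of_type_algebra S] by (simp add: ring_of_type_algebra_def)
  moreover have "x + - y \<in> int_adjoin S" "x * y \<in> int_adjoin S"
    if "x \<in> int_adjoin S" "y \<in> int_adjoin S" for x y
    using generate_ring.eng_add[OF that(1) generate_ring.a_inv[OF that(2)]]
      generate_ring.eng_mult[OF that]
    unfolding inv by (simp_all add: ring_of_type_algebra_def)
  ultimately show ?thesis
    by (simp add: unital_subring_def)
qed

text \<open>
  The strong Laurent property, applied with \<open>A\<close> the ring of rational functions that have a value at \<open>x\<close>
  and take it in \<open>B\<close>. The second part concerns \<open>m \<mapsto> somos5_formal (6 - m)\<close>, which satisfies the same
  recurrence with the same \<open>J\<close>.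
\<close>

lemma somos5_formal_values:
  fixes x :: "int \<Rightarrow> 'a::field"
  assumes B: "unital_subring B" "x 0 \<in> B" "x 6 \<in> B" "I \<in> B"
    and I: "takes_value x (indet_beta + indet_alpha * J_formal) I"
    and x: "\<And>k. k \<in> {1..5} \<Longrightarrow> x k \<in> B"
  shows "x 1 \<noteq> 0 \<Longrightarrow> x 2 \<noteq> 0 \<Longrightarrow> inverse (x 1) \<in> B \<Longrightarrow> inverse (x 2) \<in> B \<Longrightarrow> n \<ge> 1 \<Longrightarrow>
      \<exists>v\<in>B. takes_value x (somos5_formal n) v"
    and "x 5 \<noteq> 0 \<Longrightarrow> x 4 \<noteq> 0 \<Longrightarrow> inverse (x 5) \<in> B \<Longrightarrow> inverse (x 4) \<in> B \<Longrightarrow> n \<le> 5 \<Longrightarrow>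
      \<exists>v\<in>B. takes_value x (somos5_formal n) v"
proof -
  define A where "A = {r. \<exists>v\<in>B. takes_value x r v}"
  have AI: "takes_value x r v \<Longrightarrow> v \<in> B \<Longrightarrow> r \<in> A" for r v by (auto simp: A_def)
  have A: "unital_subring A" "indet_alpha \<in> A" "indet_beta \<in> A" "indet_beta + indet_alpha * J_formal \<in> A"
    using unital_subring_takes_value[OF B(1)] AI[OF takes_value_indet] AI[OF I] B by (auto simp: A_def)
  have init: "somos5_formal k \<in> A" if "k \<in> {1..5}" for k
    using that by (auto simp: somos5_formal_initial intro!: AI[OF takes_value_indet] x)
  have unit: "inverse (somos5_formal k) \<in> A" if "k \<in> {1..5}" "x k \<noteq> 0" "inverse (x k) \<in> B" for k
    using that
    by (auto simp: somos5_formal_initial intro!: AI[OF takes_value_inverse[OF takes_value_indet]])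
  {
    assume u: "x 1 \<noteq> 0" "x 2 \<noteq> 0" "inverse (x 1) \<in> B" "inverse (x 2) \<in> B" and "n \<ge> 1"
    have "(\<lambda>m. somos5_formal (int m)) (nat n) \<in> A"
    proof (rule somos5_strong_laurent[OF A companion_formal_nonzero])
      fix m :: nat
      show "somos5_rel indet_alpha indet_beta (\<lambda>m. somos5_formal (int m)) m"
        using somos5_formal_rel[of "int m"] by (simp add: somos5_rel_def add.commute)
      show "somos5_inv indet_alpha J_formal (\<lambda>m. somos5_formal (int m)) m"
        using somos5_formal_inv[of "int m"] by (simp add: somos5_inv_def add.commute)
    qed (use \<open>n \<ge> 1\<close> u in \<open>auto intro!: init unit simp: somos5_formal_nonzero\<close>)
    then show "\<exists>v\<in>B. takes_value x (somos5_formal n) v"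
      using \<open>n \<ge> 1\<close> by (simp add: A_def)
  }
  {
    assume u: "x 5 \<noteq> 0" "x 4 \<noteq> 0" "inverse (x 5) \<in> B" "inverse (x 4) \<in> B" and "n \<le> 5"
    have "(\<lambda>m. somos5_formal (6 - int m)) (nat (6 - n)) \<in> A"
    proof (rule somos5_strong_laurent[OF A companion_formal_nonzero])
      fix m :: nat
      show "somos5_rel indet_alpha indet_beta (\<lambda>m. somos5_formal (6 - int m)) m"
        using somos5_formal_rel[of "1 - int m"] by (simp add: somos5_rel_def algebra_simps)
      show "somos5_inv indet_alpha J_formal (\<lambda>m. somos5_formal (6 - int m)) m"
        using somos5_formal_inv[of "1 - int m"] by (simp add: somos5_inv_def algebra_simps)
    qed (use \<open>n \<le> 5\<close> u in \<open>auto intro!: init unit simp: somos5_formal_nonzero\<close>)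
    then show "\<exists>v\<in>B. takes_value x (somos5_formal n) v"
      using \<open>n \<le> 5\<close> by (simp add: A_def)
  }
qed

theorem theorem3p7:
  fixes \<alpha> \<beta> :: complex and t :: "int \<Rightarrow> complex"
  assumes "\<forall>i\<in>{1..5}. t i \<noteq> 0"
  shows "let \<tau> = somos5 \<alpha> \<beta> t; J = somos5_J \<alpha> \<beta> \<tau>; I = \<beta> + \<alpha> * J 3 in
    (\<forall>n::int. \<tau> (n - 2) \<noteq> 0 \<and> \<tau> (n - 1) \<noteq> 0 \<and> \<tau> n \<noteq> 0 \<and> \<tau> (n + 1) \<noteq> 0 \<and> \<tau> (n + 2) \<noteq> 0
       \<longrightarrow> J n = J 3) \<and>
    (\<forall>n::int. n \<ge> 1 \<longrightarrow>
       \<tau> n \<in> int_adjoin {\<alpha>, \<beta>, I, \<tau> 1, inverse (\<tau> 1), \<tau> 2, inverse (\<tau> 2), \<tau> 3, \<tau> 4, \<tau> 5})"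
proof -
  define x where "x = t(0 := \<alpha>, 6 := \<beta>)"
  define \<tau> where "\<tau> = somos5 \<alpha> \<beta> t"
  define J where "J = somos5_J \<alpha> \<beta> \<tau>"
  define I where "I = \<beta> + \<alpha> * J 3"
  have \<tau>: "takes_value x (somos5_formal n) v \<Longrightarrow> \<tau> n = v" for n v
    using rat_value_eqI by (auto simp: \<tau>_def somos5_def x_def)
  have init: "\<tau> k = x k" "x k \<noteq> 0" if "k \<in> {1..5}" for k
    using that assms by (auto simp: \<tau>_def somos5_initial x_def)
  have \<alpha>\<beta>: "takes_value x indet_alpha \<alpha>" "takes_value x indet_beta \<beta>"
    using takes_value_indet[of x 0] takes_value_indet[of x 6] by (simp_all add: x_def)
  have J3: "takes_value x J_formal (J 3)"
    unfolding J_def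
  proof (rule takes_value_somos5_J[OF \<alpha>\<beta>])
    fix k :: int assume "k \<in> {3 - 2..3 + 2}"
    then have "k \<in> {1..5}" by simp
    then show "takes_value x (somos5_formal k) (\<tau> k)"
      using takes_value_indet[of x k] by (simp add: somos5_formal_initial init)
  qed (simp_all add: init)
  then have I: "takes_value x (indet_beta + indet_alpha * J_formal) I"
    unfolding I_def by (intro takes_value_ops \<alpha>\<beta>)
  have U: "unital_subring UNIV" by (simp add: unital_subring_def)
  \<comment> \<open>All terms can be evaluated at \<open>x\<close>: the case that \<open>B\<close> is the whole field, using the forward sequence
    for \<open>n \<ge> 1\<close> and the reversed one otherwise.\<close>
  have val: "takes_value x (somos5_formal n) (\<tau> n)" for n
  proof -
    have "\<exists>v. takes_value x (somos5_formal n) v"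
      using somos5_formal_values[OF U _ _ _ I, of n] init(2) by (cases "n \<ge> 1") auto
    then show ?thesis using \<tau> by blast
  qed
  have "J n = J 3"
    if "\<tau> (n - 2) \<noteq> 0" "\<tau> (n - 1) \<noteq> 0" "\<tau> n \<noteq> 0" "\<tau> (n + 1) \<noteq> 0" "\<tau> (n + 2) \<noteq> 0" for n
  proof -
    have "takes_value x J_formal (J n)"
      using takes_value_somos5_J[OF \<alpha>\<beta> val that]
      unfolding J_def somos5_formal_J_constant[of n] .
    then show ?thesis
      using J3 rat_value_eqI by metis
  qed
  moreover have "\<tau> n \<in> int_adjoin {\<alpha>, \<beta>, I, \<tau> 1, inverse (\<tau> 1), \<tau> 2, inverse (\<tau> 2), \<tau> 3, \<tau> 4, \<tau> 5}"
    (is "_ \<in> int_adjoin ?S") if "n \<ge> 1" for n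
  proof -
    have S: "y \<in> ?S \<Longrightarrow> y \<in> int_adjoin ?S" for y by (rule generate_ring.incl)
    have "\<exists>v\<in>int_adjoin ?S. takes_value x (somos5_formal n) v"
    proof (rule somos5_formal_values(1)[OF unital_subring_int_adjoin _ _ _ I])
      fix k :: int assume k: "k \<in> {1..5}"
      then have "k = 1 \<or> k = 2 \<or> k = 3 \<or> k = 4 \<or> k = 5" by auto
      then have "\<tau> k \<in> ?S" by auto
      then show "x k \<in> int_adjoin ?S" using S init(1)[OF k] by simp
    next
      show "x 0 \<in> int_adjoin ?S" "x 6 \<in> int_adjoin ?S" "I \<in> int_adjoin ?S"
        by (intro S, simp add: x_def)+
      show "inverse (x 1) \<in> int_adjoin ?S" "inverse (x 2) \<in> int_adjoin ?S"
        using init(1)[of 1] init(1)[of 2] by (intro S, simp)+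
    qed (use that init(2) in auto)
    then show ?thesis using \<tau> by blast
  qed
  ultimately show ?thesis
    unfolding Let_def \<tau>_def[symmetric] J_def[symmetric] I_def[symmetric] by blast
qed

end
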